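(* Let $r\ge 2$ be an integer and set $c_2=\frac{2}{3}$, $c_3=\frac{5}{9}$ and $c_r=\frac{r}{3r-4}$ for $r>3$. If $G$ is an $r$-uniform multi-hypergraph with $m$ edges, then there is a partition of the vertex set of $G$ into $r$ parts such that each part meets at least $c_r m$ edges.
   Context: An $r$-uniform multi-hypergraph on a finite vertex set $V$ is a finite multiset of $r$-element subsets of $V$ (edges), repeated edges being allowed and counted with multiplicity. A set $X\subseteq V$ meets an edge $e$ if $X\cap e\neq\emptyset$; the number of edges meeting $X$ is counted with multiplicity. *)

theory Defs
  imports Complex_Main "HOL-Library.Multiset" "HOL-Library.Disjoint_Sets"
begin

definition uniform_multihypergraph :: "nat \<Rightarrow> 'a set \<Rightarrow> 'a set multiset \<Rightarrow> bool" where
  "uniform_multihypergraph r V E \<longleftrightarrow>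
     finite V \<and> (\<forall>e \<in># E. e \<subseteq> V \<and> card e = r)"

definition meets :: "'a set \<Rightarrow> 'a set \<Rightarrow> bool" where
  "meets X e \<longleftrightarrow> X \<inter> e \<noteq> {}"

definition num_meeting :: "'a set multiset \<Rightarrow> 'a set \<Rightarrow> nat" where
  "num_meeting E X = size (filter_mset (meets X) E)"

(* Parts are indexed and may be empty: an edgeless hypergraph may have fewer than r vertices. *)
definition partition_into :: "nat \<Rightarrow> 'a set \<Rightarrow> (nat \<Rightarrow> 'a set) \<Rightarrow> bool" where
  "partition_into r V P \<longleftrightarrow> disjoint_family_on P {..<r} \<and> (\<Union>i<r. P i) = V"

(* Only the values at r \<ge> 2 are meaningful. *)
definition c_const :: "nat \<Rightarrow> real" where
  "c_const r = (if r = 2 then 2 / 3 else if r = 3 then 5 / 9 else real r / (3 * real r - 4))"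

end

theory Submission
  imports Defs
begin

text \<open>
  The bound holds with the larger constant $(r+2)/(3r)$, by induction on $r$. Write $m$ for the number
  of edges and $t = cm$. A vertex of degree at least $t$ is made a part of its own, and the remaining
  edges are shrunk to size $r - 1$. If every degree is below $t$, take a partition maximising
  $\sum_j f(d_j)$, where $d_j$ is the number of edges meeting part $j$ and $f$ is concave with slope
  $1$ up to $4t/3$, slope $1/2$ up to $2t$ and slope $0$ beyond. Suppose that part $b$ has $d_b < t$,
  and let $H$ be the set of edges missing it. Moving single vertices into part $b$ never increases
  the potential, and summing this over the vertices of part $j$ bounds their $H$-degree sum by
  $2t - 2q_j$, where $q_j$ counts the edges of $H$ with at least two vertices in part $j$. Every edge
  of $H$ has two vertices in a common part, so summing over $j$ gives $r|H| \le 2(r-1)t - 2|H|$,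
  which contradicts $|H| > m - t$.
\<close>

section \<open>The potential and the inequality for a single part\<close>

definition util :: "real \<Rightarrow> real \<Rightarrow> real" where
  "util t d = min d (min (d / 2 + 2 * t / 3) (5 * t / 3))"

text \<open>Since \<open>l v / 2\<close> is at most \<open>l v\<close>, one term of the second kind
  already passes its deficit \<open>y / 2\<close> to the whole sum; without such a term the halves
  add up.\<close>

lemma sum_le_half_or_deficit:
  fixes g l :: "'a \<Rightarrow> real"
  assumes "finite R" "0 \<le> y"
    and "\<And>v. v \<in> R \<Longrightarrow> 0 \<le> l v"
    and "\<And>v. v \<in> R \<Longrightarrow> g v \<le> l v / 2 \<or> g v \<le> l v - y / 2"
  shows "sum g R \<le> sum l R / 2 \<or> sum g R \<le> sum l R - y / 2"
  using assms
proof (induction R rule: finite_induct)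
  case (insert v R)
  then have "sum g R \<le> sum l R / 2 \<or> sum g R \<le> sum l R - y / 2"
    and "0 \<le> l v" "g v \<le> l v / 2 \<or> g v \<le> l v - y / 2" and "0 \<le> sum l R"
    by (auto intro: sum_nonneg)
  then show ?case
    using insert.hyps \<open>0 \<le> y\<close> by auto
qed simp

text \<open>Here \<open>y\<close> is the portion of \<open>D\<close> on which \<open>util\<close>
  has slope 1/2. The gain has its kink at \<open>g = t / 3\<close>, and the bound on the loss
  reaches the value \<open>t / 3\<close> exactly at \<open>l = t / 3 + y / 2\<close>, which is the
  threshold between the two alternatives.\<close>

lemma gain_bound_cases:
  fixes t d D y g l :: real
  assumes "0 < t" "d < t" "0 \<le> g" "g < t" "0 \<le> l" "D \<le> 2 * t"
    and y: "y = max 0 (D - 4 * t / 3)"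
    and opt: "util t (d + g) + util t (D - l) \<le> util t d + util t D"
  shows "(l \<le> t / 3 + y / 2 \<and> (g \<le> l / 2 \<or> g \<le> l - y / 2)) \<or>
         (t / 3 + y / 2 < l \<and> g \<le> 2 * l - y - t / 3)"
proof -
  \<comment> \<open>As \<open>d < t\<close>, slope 1 lasts for at least \<open>t / 3\<close> more
    edges; as \<open>d + g < 2 * t\<close>, the slope afterwards is still at least 1/2.\<close>
  have gain: "min g (g / 2 + t / 6) \<le> util t (d + g) - util t d"
    using assms(1-4) unfolding util_def min_def by (auto simp: field_simps split: if_splits)
  have "util t D = D - y / 2"
    using assms(6) y unfolding util_def min_def max_def by (auto simp: field_simps split: if_splits)
  \<comment> \<open>The flat piece is never strictly the smallest here, because \<open>D - l\<close>
    is at most \<open>2 * t\<close>.\<close>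
  moreover have "D - l \<le> util t (D - l) \<or> (D - l) / 2 + 2 * t / 3 \<le> util t (D - l)"
    using assms(5,6) unfolding util_def min_def by (auto simp: field_simps)
  moreover have "D - 4 * t / 3 \<le> y"
    using y by simp
  ultimately have loss: "util t D - util t (D - l) \<le> max (l / 2) (l - y / 2)"
    unfolding le_max_iff_disj by argo
  have "0 \<le> y" "y \<le> 2 * t / 3"
    using assms(1,6) y by (auto simp: max_def)
  moreover have "min g (g / 2 + t / 6) \<le> max (l / 2) (l - y / 2)"
    using gain loss opt by linarith
  ultimately show ?thesis
    using assms(1,3,5) unfolding min_def max_def by (auto split: if_splits)
qed

text \<open>
  Here \<open>d\<close> is the degree of the deficient part and \<open>D\<close> that of the part \<open>S\<close>; moving \<open>v\<close> from \<open>S\<close> to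
  the deficient part gains \<open>g v\<close> edges there and loses \<open>l v\<close> in \<open>S\<close>. The last assumption says that every
  edge counted by \<open>q\<close> keeps a vertex in \<open>S\<close> when one vertex is deleted.
\<close>

lemma part_bound_uncapped:
  fixes g l :: "'a \<Rightarrow> real" and t d D q :: real
  assumes fin: "finite S" and t: "0 < t" and d: "d < t" and D: "D \<le> 2 * t"
    and g: "\<And>v. v \<in> S \<Longrightarrow> 0 \<le> g v \<and> g v < t"
    and l: "\<And>v. v \<in> S \<Longrightarrow> 0 \<le> l v"
    and opt: "\<And>v. v \<in> S \<Longrightarrow> util t (d + g v) + util t (D - l v) \<le> util t d + util t D"
    and suml: "sum l S \<le> D - q"
    and q: "2 * q \<le> sum g S" "\<And>w. w \<in> S \<Longrightarrow> q \<le> sum g (S - {w})"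
  shows "sum g S \<le> 2 * t - 2 * q"
proof -
  define y where "y = max 0 (D - 4 * t / 3)"
  have y: "0 \<le> y" "y \<le> 2 * t / 3" "sum l S \<le> 4 * t / 3 + y - q"
    using t D suml by (auto simp: y_def max_def)
  \<comment> \<open>\<open>P\<close> collects the vertices of large loss; the cases are that it has
    none, one, or at least two elements.\<close>
  define P where "P = {v \<in> S. t / 3 + y / 2 < l v}"
  have P: "g v \<le> 2 * l v - y - t / 3" if "v \<in> P" for v
    using gain_bound_cases[OF t d _ _ _ D y_def opt[of v]] g[of v] l[of v] that
    by (auto simp: P_def)
  have notP: "l v \<le> t / 3 + y / 2" "g v \<le> l v / 2 \<or> g v \<le> l v - y / 2"
    if "v \<in> S" "v \<notin> P" for v
    using gain_bound_cases[OF t d _ _ _ D y_def opt[of v]] g[of v] l[of v] that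
    by (auto simp: P_def)
  have split: "sum f S = f v + sum f (S - {v})" if "v \<in> S" for f :: "'a \<Rightarrow> real" and v
    using fin that by (rule sum.remove)
  consider "P = {}" | v where "P = {v}" | v w where "v \<in> P" "w \<in> P" "v \<noteq> w"
    by blast
  then show ?thesis
  proof cases
    case 1
    show ?thesis
    proof (cases "\<forall>v\<in>S. g v \<le> l v / 2")
      case True
      then have "sum g S \<le> sum l S / 2"
        by (simp add: sum_divide_distrib sum_mono)
      then show ?thesis
        using y q(1) by linarith
    next
      case False
      \<comment> \<open>This \<open>w\<close> satisfies \<open>g w \<le> t / 3\<close>, and the
        remaining vertices obey the half-or-deficit bound.\<close>
      then obtain w where w: "w \<in> S" "g w \<le> l w - y / 2" "l w \<le> t / 3 + y / 2"
        using notP 1 by blast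
      have "sum g (S - {w}) \<le> sum l (S - {w}) / 2 \<or> sum g (S - {w}) \<le> sum l (S - {w}) - y / 2"
        by (rule sum_le_half_or_deficit) (use fin y l notP 1 in auto)
      then show ?thesis
        using y q(1) w split[OF w(1), of g] split[OF w(1), of l] t by linarith
    qed
  next
    case (2 v)
    then have v: "v \<in> S" "g v \<le> 2 * l v - y - t / 3" "g v < t"
      using P[of v] g[of v] by (auto simp: P_def)
    \<comment> \<open>Here \<open>g v < t\<close> is essential, and \<open>q\<close> is compared
      with the sum over the other vertices only.\<close>
    have "sum g (S - {v}) \<le> sum l (S - {v}) / 2 \<or> sum g (S - {v}) \<le> sum l (S - {v}) - y / 2"
      by (rule sum_le_half_or_deficit) (use fin y l notP 2 in auto)
    then show ?thesis
      using y q(2)[OF v(1)] v split[OF v(1), of g] split[OF v(1), of l] t by linarith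
  next
    case (3 v w)
    then have vw: "v \<in> S" "w \<in> S - {v}"
      by (auto simp: P_def)
    \<comment> \<open>Each of \<open>v\<close> and \<open>w\<close> saves \<open>y + t / 3\<close>
      against the bound \<open>2 * l\<close>, and
      \<open>2 * (4 * t / 3 + y - q) - 2 * (y + t / 3)\<close> is exactly
      \<open>2 * t - 2 * q\<close>.\<close>
    have "sum g (S - {v} - {w}) \<le> (\<Sum>u\<in>S - {v} - {w}. 2 * l u)"
    proof (rule sum_mono)
      fix u assume "u \<in> S - {v} - {w}"
      then show "g u \<le> 2 * l u"
        using P[of u] notP[of u] l[of u] y t by force
    qed
    also have "\<dots> = 2 * sum l (S - {v} - {w})"
      by (simp add: sum_distrib_left)
    finally show ?thesis
      using y P[OF 3(1)] P[OF 3(2)] split[OF vw(1), of g] split[OF vw(1), of l]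
        sum.remove[OF _ vw(2), of g] sum.remove[OF _ vw(2), of l] fin by force
  qed
qed

text \<open>Removes the restriction \<open>D \<le> 2 * t\<close>, using that \<open>util\<close> is
  constant beyond \<open>2 * t\<close>.\<close>

lemma part_bound:
  fixes g l :: "'a \<Rightarrow> real" and t d D q :: real
  assumes fin: "finite S" and t: "0 < t" and d: "d < t"
    and g: "\<And>v. v \<in> S \<Longrightarrow> 0 \<le> g v \<and> g v < t"
    and l: "\<And>v. v \<in> S \<Longrightarrow> 0 \<le> l v"
    and opt: "\<And>v. v \<in> S \<Longrightarrow> util t (d + g v) + util t (D - l v) \<le> util t d + util t D"
    and suml: "sum l S \<le> D - q"
    and q: "2 * q \<le> sum g S" "\<And>w. w \<in> S \<Longrightarrow> q \<le> sum g (S - {w})"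
  shows "sum g S \<le> 2 * t - 2 * q"
proof (cases "D \<le> 2 * t")
  case True
  then show ?thesis
    using part_bound_uncapped[OF fin t d _ g l opt suml q] by blast
next
  case False
  \<comment> \<open>The surplus \<open>z\<close> is worthless, so it can be taken off \<open>D\<close> and off every loss.\<close>
  define z where "z = D - 2 * t"
  define l' where "l' v = max 0 (l v - z)" for v
  have z: "0 < z"
    using False by (simp add: z_def)
  have opt': "util t (d + g v) + util t (2 * t - l' v) \<le> util t d + util t (2 * t)" if "v \<in> S" for v
    using opt[OF that] False t unfolding util_def l'_def z_def min_def max_def
    by (auto split: if_splits)
  show ?thesis
  proof (cases "\<exists>w\<in>S. z < l w")
    case True
    then obtain w where w: "w \<in> S" "z < l w" by blast
    \<comment> \<open>The single loss \<open>l w\<close> absorbs all of \<open>z\<close>, so the sum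
      of the losses drops by at least \<open>z\<close>.\<close>
    have "sum l' (S - {w}) \<le> sum l (S - {w})"
      by (rule sum_mono) (use l z in \<open>auto simp: l'_def\<close>)
    moreover have "l' w = l w - z"
      using w by (simp add: l'_def)
    ultimately have "sum l' S \<le> 2 * t - q"
      using suml sum.remove[OF fin w(1), of l] sum.remove[OF fin w(1), of l']
      by (simp add: z_def)
    then show ?thesis
      using part_bound_uncapped[OF fin t d _ g _ opt' _ q] by (simp add: l'_def)
  next
    case False
    \<comment> \<open>Every move out of \<open>S\<close> is now free, so optimality leaves nothing
      to gain.\<close>
    have "g v = 0" if "v \<in> S" for v
    proof -
      have "l' v = 0"
        using False that by (auto simp: l'_def)
      then have "util t (d + g v) \<le> util t d"
        using opt'[OF that] by simp
      then show ?thesis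
        using g[OF that] d t unfolding util_def min_def by (auto simp: field_simps split: if_splits)
    qed
    then have "sum g S = 0" by simp
    then show ?thesis
      using q(1) t by linarith
  qed
qed

section \<open>Colour degrees and the effect of recolouring one vertex\<close>

text \<open>Edges carry indices, so repeated edges count separately and edges that become equal
  after shrinking stay distinct.\<close>

definition colour_deg :: "'b set \<Rightarrow> ('b \<Rightarrow> 'a set) \<Rightarrow> ('a \<Rightarrow> nat) \<Rightarrow> nat \<Rightarrow> nat" where
  "colour_deg I ed col j = card {i \<in> I. \<exists>v\<in>ed i. col v = j}"

lemma sum_degree_swap:
  assumes "finite A" "finite H"
  shows "(\<Sum>v\<in>A. card {i \<in> H. v \<in> ed i}) = (\<Sum>i\<in>H. card (A \<inter> ed i))"
proof -
  have "(\<Sum>v\<in>A. card {i \<in> H. v \<in> ed i}) = (\<Sum>v\<in>A. \<Sum>i\<in>H. if v \<in> ed i then 1 else 0)"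
    using assms by (simp add: sum.If_cases Int_def)
  also have "\<dots> = (\<Sum>i\<in>H. \<Sum>v\<in>A. if v \<in> ed i then 1 else 0)"
    by (rule sum.swap)
  also have "\<dots> = (\<Sum>i\<in>H. card (A \<inter> ed i))"
    using assms by (simp add: sum.If_cases Int_def)
  finally show ?thesis .
qed

lemma exists_max_colouring:
  fixes F :: "('a \<Rightarrow> nat) \<Rightarrow> real"
  assumes "finite V" "0 < r"
  obtains col where "col \<in> V \<rightarrow>\<^sub>E {..<r}" "\<And>c. c \<in> V \<rightarrow>\<^sub>E {..<r} \<Longrightarrow> F c \<le> F col"
proof -
  let ?S = "V \<rightarrow>\<^sub>E {..<r}"
  have fin: "finite ?S"
    using assms(1) by (intro finite_PiE) auto
  have "?S \<noteq> {}"
    using assms(2) by (auto simp: PiE_eq_empty_iff)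
  then have "Max (F ` ?S) \<in> F ` ?S"
    using fin by (intro Max_in) auto
  then obtain col where "col \<in> ?S" "F col = Max (F ` ?S)"
    by auto
  then show thesis
    using fin that by simp
qed

lemma colour_deg_recolour_gain:
  assumes "finite I" "col v \<noteq> b"
  shows "colour_deg I ed (col(v := b)) b =
    colour_deg I ed col b + card {i \<in> {i \<in> I. \<forall>u\<in>ed i. col u \<noteq> b}. v \<in> ed i}"
proof -
  have "{i \<in> I. \<exists>u\<in>ed i. (col(v := b)) u = b} =
    {i \<in> I. \<exists>u\<in>ed i. col u = b} \<union> {i \<in> {i \<in> I. \<forall>u\<in>ed i. col u \<noteq> b}. v \<in> ed i}"
    using assms(2) by auto
  then show ?thesis
    unfolding colour_deg_def using assms(1)
    by (simp only:) (rule card_Un_disjoint; auto)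
qed

lemma colour_deg_recolour_loss:
  assumes "finite I" "col v = j" "j \<noteq> b"
  shows "colour_deg I ed col j =
    colour_deg I ed (col(v := b)) j + card {i \<in> I. {u \<in> ed i. col u = j} = {v}}"
proof -
  have "{i \<in> I. \<exists>u\<in>ed i. col u = j} =
    {i \<in> I. \<exists>u\<in>ed i. (col(v := b)) u = j} \<union> {i \<in> I. {u \<in> ed i. col u = j} = {v}}"
    using assms(2,3) by auto
  then show ?thesis
    unfolding colour_deg_def using assms(1,3)
    by (simp only:) (rule card_Un_disjoint; auto split: if_splits)
qed

lemma colour_deg_recolour_other:
  assumes "k \<noteq> b" "k \<noteq> col v"
  shows "colour_deg I ed (col(v := b)) k = colour_deg I ed col k"
  unfolding colour_deg_def using assms by (intro arg_cong[where f = card]) auto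

section \<open>Maximising the potential when all degrees are small\<close>

lemma judicious_colouring_low_degree:
  fixes ed :: "'b \<Rightarrow> 'a set" and t :: real
  assumes finI: "finite I" and finV: "finite V" and r: "0 < r" and t: "0 < t"
    and ed: "\<And>i. i \<in> I \<Longrightarrow> ed i \<subseteq> V \<and> card (ed i) = r"
    and deg: "\<And>v. v \<in> V \<Longrightarrow> card {i \<in> I. v \<in> ed i} < t"
    and tm: "3 * real r * t \<le> (real r + 2) * card I"
  shows "\<exists>col. col \<in> V \<rightarrow> {..<r} \<and> (\<forall>j<r. t \<le> colour_deg I ed col j)"
proof -
  define F where "F col = (\<Sum>j<r. util t (colour_deg I ed col j))" for col
  obtain col where col: "col \<in> V \<rightarrow>\<^sub>E {..<r}" and max: "\<And>c. c \<in> V \<rightarrow>\<^sub>E {..<r} \<Longrightarrow> F c \<le> F col"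
    using exists_max_colouring[OF finV r] by blast
  have "t \<le> colour_deg I ed col b" if "b < r" for b
  proof (rule ccontr)
    assume "\<not> ?thesis"
    then have bad: "real (colour_deg I ed col b) < t" by simp
    define H where "H = {i \<in> I. \<forall>u\<in>ed i. col u \<noteq> b}"
    define J where "J = {..<r} - {b}"
    define S where "S j = {v \<in> V. col v = j}" for j
    define g where "g v = real (card {i \<in> H. v \<in> ed i})" for v
    define l where "l v = real (card {i \<in> I. {u \<in> ed i. col u = col v} = {v}})" for v
    define Q where "Q j = {i \<in> H. 2 \<le> card (S j \<inter> ed i)}" for j
    have finH: "finite H" and HI: "H \<subseteq> I" and finS: "finite (S j)" and finQ: "finite (Q j)"
      and QH: "Q j \<subseteq> H" for j
      using finI finV by (auto simp: H_def S_def Q_def)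
    have opt: "util t (colour_deg I ed col b + g v) + util t (colour_deg I ed col j - l v)
        \<le> util t (colour_deg I ed col b) + util t (colour_deg I ed col j)"
      if "j \<in> J" "v \<in> S j" for j v
    proof -
      let ?c = "col(v := b)"
      have v: "v \<in> V" "col v = j" "j \<noteq> b" "j < r"
        using that by (auto simp: J_def S_def)
      have "?c \<in> V \<rightarrow>\<^sub>E {..<r}"
        using col v(1) \<open>b < r\<close> by (auto simp: PiE_iff extensional_def)
      then have "F ?c \<le> F col"
        by (rule max)
      moreover have "F c = util t (colour_deg I ed c b) + (util t (colour_deg I ed c j)
          + (\<Sum>k\<in>J - {j}. util t (colour_deg I ed c k)))" for c
      proof -
        have "F c = util t (colour_deg I ed c b) + (\<Sum>k\<in>J. util t (colour_deg I ed c k))"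
          unfolding F_def J_def using \<open>b < r\<close> by (intro sum.remove) auto
        also have "(\<Sum>k\<in>J. util t (colour_deg I ed c k)) = util t (colour_deg I ed c j)
            + (\<Sum>k\<in>J - {j}. util t (colour_deg I ed c k))"
          using that(1) by (intro sum.remove) (auto simp: J_def)
        finally show ?thesis .
      qed
      moreover have "(\<Sum>k\<in>J - {j}. util t (colour_deg I ed ?c k))
          = (\<Sum>k\<in>J - {j}. util t (colour_deg I ed col k))"
        by (rule sum.cong) (use v in \<open>auto simp: J_def colour_deg_recolour_other\<close>)
      moreover have "real (colour_deg I ed ?c b) = colour_deg I ed col b + g v"
        using colour_deg_recolour_gain[OF finI, of col v b ed] v by (simp add: g_def H_def)
      moreover have "real (colour_deg I ed ?c j) = colour_deg I ed col j - l v"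
        using colour_deg_recolour_loss[where col = col and v = v and ed = ed, OF finI v(2,3)] v
        by (simp add: l_def)
      ultimately show ?thesis
        by simp
    qed
    have swap: "sum g A = real (\<Sum>i\<in>H. card (A \<inter> ed i))" if "finite A" for A
      by (simp add: g_def sum_degree_swap[OF that finH] flip: of_nat_sum)
    have part: "sum g (S j) \<le> 2 * t - 2 * real (card (Q j))" if j: "j \<in> J" for j
    proof (rule part_bound[OF finS t bad])
      fix v assume v: "v \<in> S j"
      have "card {i \<in> H. v \<in> ed i} \<le> card {i \<in> I. v \<in> ed i}"
        using HI finI by (intro card_mono) auto
      then show "0 \<le> g v \<and> g v < t"
        using deg[of v] v by (auto simp: g_def S_def)
      show "0 \<le> l v"
        by (simp add: l_def)
      show "util t (colour_deg I ed col b + g v) + util t (colour_deg I ed col j - l v)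
        \<le> util t (colour_deg I ed col b) + util t (colour_deg I ed col j)"
        using opt[OF j v] .
    next
      let ?L = "\<lambda>v. {i \<in> I. {u \<in> ed i. col u = j} = {v}}"
      have Sj: "S j \<inter> ed i = {u \<in> ed i. col u = j}" if "i \<in> I" for i
        using ed[OF that] by (auto simp: S_def)
      have "sum l (S j) = real (\<Sum>v\<in>S j. card (?L v))"
        by (simp add: l_def S_def)
      also have "(\<Sum>v\<in>S j. card (?L v)) = card (\<Union>v\<in>S j. ?L v)"
        using finI finS by (intro card_UN_disjoint[symmetric]) auto
      finally have suml: "sum l (S j) = real (card (\<Union>v\<in>S j. ?L v))" .
      \<comment> \<open>Edges with exactly one vertex in \<open>S j\<close> and edges of
        \<open>Q j\<close> form disjoint families among the edges meeting \<open>S j\<close>; this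
        gives the bound \<open>D - q\<close> on the losses.\<close>
      have "(\<Union>v\<in>S j. ?L v) \<inter> Q j = {}"
        using HI Sj by (auto simp: Q_def)
      then have "card (\<Union>v\<in>S j. ?L v) + card (Q j) = card ((\<Union>v\<in>S j. ?L v) \<union> Q j)"
        using finI finS finQ by (intro card_Un_disjoint[symmetric]) auto
      also have "\<dots> \<le> colour_deg I ed col j"
        unfolding colour_deg_def
      proof (rule card_mono)
        have "\<exists>u\<in>ed i. col u = j" if "i \<in> Q j" for i
        proof -
          have "S j \<inter> ed i \<noteq> {}"
            using that by (auto simp: Q_def)
          then show ?thesis by (auto simp: S_def)
        qed
        then show "(\<Union>v\<in>S j. ?L v) \<union> Q j \<subseteq> {i \<in> I. \<exists>v\<in>ed i. col v = j}"
          using QH HI by blast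
      qed (use finI in simp)
      finally show "sum l (S j) \<le> real (colour_deg I ed col j) - real (card (Q j))"
        using suml by linarith
    next
      have "card (Q j) * 2 = (\<Sum>i\<in>Q j. 2)" by simp
      also have "\<dots> \<le> (\<Sum>i\<in>Q j. card (S j \<inter> ed i))"
        by (rule sum_mono) (simp add: Q_def)
      also have "\<dots> \<le> (\<Sum>i\<in>H. card (S j \<inter> ed i))"
        by (rule sum_mono2[OF finH QH]) simp
      finally show "2 * real (card (Q j)) \<le> sum g (S j)"
        unfolding swap[OF finS] by linarith
    next
      fix w
      have "card (Q j) = (\<Sum>i\<in>Q j. 1)" by simp
      also have "\<dots> \<le> (\<Sum>i\<in>Q j. card ((S j - {w}) \<inter> ed i))"
      proof (rule sum_mono)
        fix i assume "i \<in> Q j"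
        then have "2 \<le> card (S j \<inter> ed i)"
          by (simp add: Q_def)
        then have "1 \<le> card (S j \<inter> ed i - {w})"
          using diff_card_le_card_Diff[of "{w}" "S j \<inter> ed i"] by simp
        moreover have "(S j - {w}) \<inter> ed i = S j \<inter> ed i - {w}" by blast
        ultimately show "1 \<le> card ((S j - {w}) \<inter> ed i)"
          by simp
      qed
      also have "\<dots> \<le> (\<Sum>i\<in>H. card ((S j - {w}) \<inter> ed i))"
        by (rule sum_mono2[OF finH QH]) simp
      finally show "real (card (Q j)) \<le> sum g (S j - {w})"
        using finS by (simp add: swap del: of_nat_sum)
    qed
    have cards: "(\<Sum>j\<in>J. card (S j \<inter> ed i)) = r" if i: "i \<in> H" for i
    proof -
      have "ed i = (\<Union>j\<in>J. S j \<inter> ed i)"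
        using i ed[of i] col by (fastforce simp: H_def J_def S_def)
      moreover have "card (\<Union>j\<in>J. S j \<inter> ed i) = (\<Sum>j\<in>J. card (S j \<inter> ed i))"
        using finS by (intro card_UN_disjoint) (auto simp: J_def S_def)
      ultimately show ?thesis
        using ed[of i] i HI by auto
    qed
    have cardJ: "card J = r - 1"
      using \<open>b < r\<close> by (simp add: J_def)
    \<comment> \<open>Pigeonhole: an edge of \<open>H\<close> has \<open>r\<close> vertices but only
      the \<open>r - 1\<close> colours of \<open>J\<close>.\<close>
    have "H \<subseteq> (\<Union>j\<in>J. Q j)"
    proof
      fix i assume i: "i \<in> H"
      show "i \<in> (\<Union>j\<in>J. Q j)"
      proof (rule ccontr)
        assume "\<not> ?thesis"
        then have "card (S j \<inter> ed i) \<le> 1" if "j \<in> J" for j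
          using i that by (force simp: Q_def)
        then have "(\<Sum>j\<in>J. card (S j \<inter> ed i)) \<le> (\<Sum>j\<in>J. 1)"
          by (intro sum_mono) auto
        then show False
          using cards[OF i] cardJ r by simp
      qed
    qed
    then have "card H \<le> card (\<Union>j\<in>J. Q j)"
      using finQ by (intro card_mono) (auto simp: J_def)
    also have "\<dots> \<le> (\<Sum>j\<in>J. card (Q j))"
      by (rule card_UN_le) (simp add: J_def)
    finally have HQ: "real (card H) \<le> (\<Sum>j\<in>J. real (card (Q j)))"
      by (simp flip: of_nat_sum)
    have "real r * card H = real (\<Sum>i\<in>H. \<Sum>j\<in>J. card (S j \<inter> ed i))"
      using cards by simp
    also have "(\<Sum>i\<in>H. \<Sum>j\<in>J. card (S j \<inter> ed i)) = (\<Sum>j\<in>J. \<Sum>i\<in>H. card (S j \<inter> ed i))"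
      by (rule sum.swap)
    also have "real \<dots> = (\<Sum>j\<in>J. sum g (S j))"
      by (simp add: swap[OF finS])
    also have "\<dots> \<le> (\<Sum>j\<in>J. 2 * t - 2 * real (card (Q j)))"
      by (rule sum_mono) (rule part)
    also have "\<dots> = 2 * (real r - 1) * t - 2 * (\<Sum>j\<in>J. real (card (Q j)))"
      using cardJ r by (simp add: sum_subtractf sum_distrib_left of_nat_diff)
    finally have "(real r + 2) * card H \<le> 2 * (real r - 1) * t"
      using HQ by (simp add: algebra_simps)
    moreover have "card I = colour_deg I ed col b + card H"
    proof -
      have "I = {i \<in> I. \<exists>v\<in>ed i. col v = b} \<union> H"
        by (auto simp: H_def)
      moreover have "card ({i \<in> I. \<exists>v\<in>ed i. col v = b} \<union> H)
          = card {i \<in> I. \<exists>v\<in>ed i. col v = b} + card H"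
        using finI finH by (intro card_Un_disjoint) (auto simp: H_def)
      ultimately show ?thesis
        by (simp add: colour_deg_def)
    qed
    \<comment> \<open>With \<open>m = card I\<close>, the two bounds on \<open>card H\<close>
      combine to \<open>(r + 2) * m < 3 * r * t\<close>; this is where the constant
      \<open>(r + 2) / (3 * r)\<close> comes from.\<close>
    then have "card I - t < card H"
      using bad by simp
    then have "(real r + 2) * (card I - t) < (real r + 2) * card H"
      by (intro mult_strict_left_mono) auto
    ultimately show False
      using tm by (simp add: algebra_simps)
  qed
  then show ?thesis
    using col by (intro exI[of _ col]) auto
qed

section \<open>Induction on the edge size\<close>

text \<open>The ratio \<open>(r + 2) / (3 * r)\<close> decreases in \<open>r\<close>, so the same
  \<open>t\<close> stays admissible when edges lose a vertex. Hence \<open>I\<close> and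
  \<open>t\<close> are fixed in the induction while \<open>V\<close> and \<open>ed\<close>
  vary.\<close>

lemma judicious_colouring:
  fixes ed :: "'b \<Rightarrow> 'a set" and t :: real
  assumes "finite I" "finite V"
    and "\<And>i. i \<in> I \<Longrightarrow> ed i \<subseteq> V \<and> card (ed i) = Suc k"
    and "3 * real (Suc k) * t \<le> (real (Suc k) + 2) * card I"
  shows "\<exists>col. col \<in> V \<rightarrow> {..<Suc k} \<and> (\<forall>j<Suc k. t \<le> colour_deg I ed col j)"
  using assms
proof (induction k arbitrary: V ed)
  case 0
  have "ed i \<noteq> {}" if "i \<in> I" for i
    using 0(3)[OF that] by auto
  then have "{i \<in> I. \<exists>v\<in>ed i. (0::nat) = 0} = I"
    by blast
  then show ?case
    using 0(4) by (intro exI[of _ "\<lambda>_. 0"]) (auto simp: colour_deg_def)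
next
  case (Suc k)
  note fin = Suc.prems(1,2) and ed = Suc.prems(3) and tm = Suc.prems(4)
  consider "t \<le> 0" | "0 < t" "\<forall>v\<in>V. card {i \<in> I. v \<in> ed i} < t"
    | v where "v \<in> V" "t \<le> card {i \<in> I. v \<in> ed i}"
    by fastforce
  then show ?case
  proof cases
    case 1
    then show ?thesis
      by (intro exI[of _ "\<lambda>_. 0"]) (auto intro: order_trans)
  next
    case 2
    then show ?thesis
      using judicious_colouring_low_degree[OF fin _ 2(1) ed _ tm] by auto
  next
    case (3 v)
    \<comment> \<open>Edges avoiding \<open>v\<close> give up an arbitrary vertex, so that
      uniformity is kept.\<close>
    have "\<exists>e. e \<subseteq> ed i - {v} \<and> card e = Suc k" if "i \<in> I" for i
    proof -
      have "finite (ed i)"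
        using ed[OF that] fin(2) finite_subset by blast
      then have "Suc k \<le> card (ed i - {v})"
        using ed[OF that] card_Diff_singleton_if[of "ed i" v] by simp
      then show ?thesis
        using obtain_subset_with_card_n by metis
    qed
    then obtain ed' where ed': "\<And>i. i \<in> I \<Longrightarrow> ed' i \<subseteq> ed i - {v} \<and> card (ed' i) = Suc k"
      by metis
    have "3 * real (Suc k) * t \<le> (real (Suc k) + 2) * card I"
    \<comment> \<open>The monotonicity is cross-multiplied:
      \<open>(k + 1) * (k + 4) \<le> (k + 2) * (k + 3)\<close>.\<close>
    proof -
      have "real (Suc (Suc k)) * (3 * real (Suc k) * t)
          \<le> real (Suc k) * ((real (Suc (Suc k)) + 2) * card I)"
        using mult_left_mono[OF tm, of "real (Suc k)"] by (simp only: mult_ac)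
      also have "\<dots> \<le> real (Suc (Suc k)) * ((real (Suc k) + 2) * card I)"
        by (simp add: algebra_simps)
      finally show ?thesis
        by (rule mult_left_le_imp_le) simp
    qed
    then obtain col where col: "col \<in> V - {v} \<rightarrow> {..<Suc k}"
      "\<forall>j<Suc k. t \<le> colour_deg I ed' col j"
      using Suc.IH[of "V - {v}" ed'] fin ed ed' by blast
    let ?c = "col(v := Suc k)"
    have "?c \<in> V \<rightarrow> {..<Suc (Suc k)}"
      using col(1) by (auto simp: Pi_iff less_Suc_eq)
    moreover have "t \<le> colour_deg I ed ?c j" if "j < Suc (Suc k)" for j
    proof (cases "j = Suc k")
      case True
      have "card {i \<in> I. v \<in> ed i} \<le> colour_deg I ed ?c j"
        unfolding colour_deg_def using fin True by (intro card_mono) auto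
      then show ?thesis
        using 3(2) by linarith
    next
      case False
      have "colour_deg I ed' col j \<le> colour_deg I ed ?c j"
        unfolding colour_deg_def
      proof (rule card_mono)
        show "{i \<in> I. \<exists>u\<in>ed' i. col u = j} \<subseteq> {i \<in> I. \<exists>u\<in>ed i. ?c u = j}"
          using ed' by fastforce
      qed (use fin in simp)
      moreover have "t \<le> colour_deg I ed' col j"
        using col(2) False that by simp
      ultimately show ?thesis by linarith
    qed
    ultimately show ?thesis by blast
  qed
qed

section \<open>From the stronger constant to the stated one\<close>

text \<open>Equality holds for \<open>r\<close> equal to 2, 3 and 4; from 4 on, clearing the
  denominator leaves \<open>8 \<le> 2 * r\<close>.\<close>

lemma c_const_le:
  assumes "2 \<le> r"
  shows "3 * real r * c_const r \<le> real r + 2"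
proof -
  consider "r = 2" | "r = 3" | "4 \<le> r"
    using assms by linarith
  then show ?thesis
  proof cases
    case 3
    then have "4 \<le> real r" by simp
    then show ?thesis
      using 3 by (simp add: c_const_def field_simps)
  qed (simp_all add: c_const_def)
qed

theorem theorem5:
  fixes r :: nat and V :: "'a set" and E :: "'a set multiset"
  assumes "r \<ge> 2"
    and "uniform_multihypergraph r V E"
  shows "\<exists>P. partition_into r V P \<and> (\<forall>i<r. real (num_meeting E (P i)) \<ge> c_const r * real (size E))"
proof -
  \<comment> \<open>List positions serve as edge indices and preserve multiplicity.\<close>
  obtain xs where xs: "mset xs = E"
    using ex_mset by blast
  have ed: "xs ! i \<subseteq> V \<and> card (xs ! i) = r" if "i \<in> {..<length xs}" for i
    using assms(2) xs that by (auto simp: uniform_multihypergraph_def)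
  have finV: "finite V"
    using assms(2) by (simp add: uniform_multihypergraph_def)
  obtain k where k: "r = Suc k"
    using assms(1) by (cases r) auto
  have "3 * real r * (c_const r * size E) \<le> (real r + 2) * card {..<length xs}"
    using mult_right_mono[OF c_const_le[OF assms(1)], of "real (size E)"] xs
    by (auto simp: algebra_simps)
  then obtain col where col: "col \<in> V \<rightarrow> {..<r}"
    and deg: "\<And>j. j < r \<Longrightarrow> c_const r * size E \<le> colour_deg {..<length xs} ((!) xs) col j"
    using judicious_colouring[of "{..<length xs}" V "(!) xs" k "c_const r * size E"] finV ed k
    by auto
  let ?P = "\<lambda>j. {v \<in> V. col v = j}"
  have "partition_into r V ?P"
    using col by (auto simp: partition_into_def disjoint_family_on_def)
  moreover have "num_meeting E (?P j) = colour_deg {..<length xs} ((!) xs) col j" for j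
  proof -
    have "num_meeting E (?P j) = length (filter (meets (?P j)) xs)"
      by (simp add: num_meeting_def flip: xs mset_filter)
    also have "\<dots> = card {i. i < length xs \<and> meets (?P j) (xs ! i)}"
      by (rule length_filter_conv_card)
    also have "{i. i < length xs \<and> meets (?P j) (xs ! i)}
        = {i \<in> {..<length xs}. \<exists>v\<in>xs ! i. col v = j}"
      using ed by (fastforce simp: meets_def)
    finally show ?thesis
      by (simp add: colour_deg_def)
  qed
  ultimately show ?thesis
    using deg by (intro exI[of _ ?P]) auto
qed

end
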